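(* The principal 3D slice $\mathcal{T}(\mathbf{j_1},\mathbf{j_2},\mathbf{j_3})$ of the tricomplex Mandelbrot set (the Firebrot) can be characterized as $$\mathcal{T}(\mathbf{j_1},\mathbf{j_2},\mathbf{j_3}) = \bigcup_{y \in [-\frac{1}{4},\frac{1}{4}]}\{[(\mathcal{H}'+y\,\mathbf{j_1})\cap(-\mathcal{H}'-y\,\mathbf{j_1})] + y\,\mathbf{j_2}\},$$ where $\mathcal{H}' := \{c_{7}\mathbf{j_3}+c_{4}\mathbf{j_1}: c_4,c_7\in\mathbb{R},\ c_{7}+c_{4}\mathbf{j_1} \in \mathcal{H}\}$ and $\mathcal{H}$ is the hyperbolic Mandelbrot set.
   Context: The tricomplex numbers $\mathbb{TC}$ form the commutative, associative unital real algebra generated by three commuting elements $\mathbf{i_1},\mathbf{i_2},\mathbf{i_3}$ with $\mathbf{i_1}^2=\mathbf{i_2}^2=\mathbf{i_3}^2=-1$; it has dimension 8 over $\mathbb{R}$ with basis $1,\mathbf{i_1},\mathbf{i_2},\mathbf{j_1},\mathbf{i_3},\mathbf{j_2},\mathbf{j_3},\mathbf{i_4}$, where $\mathbf{j_1}=\mathbf{i_1}\mathbf{i_2}$, $\mathbf{j_2}=\mathbf{i_1}\mathbf{i_3}$, $\mathbf{j_3}=\mathbf{i_2}\mathbf{i_3}$ and $\mathbf{i_4}=\mathbf{i_1}\mathbf{i_2}\mathbf{i_3}$. Boundedness in $\mathbb{TC}\cong\mathbb{R}^8$ is with respect to the Euclidean norm. For $c\in\mathbb{TC}$ let $P_c(\eta)=\eta^2+c$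 and let $P_c^{(n)}$ be its $n$-fold composition. The tricomplex Mandelbrot set is $\mathcal{M}_3=\{c\in\mathbb{TC}:\{P_c^{(n)}(0)\}_{n\in\mathbb{N}}\text{ is bounded}\}$. For three distinct units $\mathbf{u},\mathbf{v},\mathbf{w}\in\{1,\mathbf{i_1},\mathbf{i_2},\mathbf{j_1},\mathbf{i_3},\mathbf{j_2},\mathbf{j_3},\mathbf{i_4}\}$, the principal 3D slice is $\mathcal{T}(\mathbf{u},\mathbf{v},\mathbf{w})=\mathrm{span}_{\mathbb{R}}\{\mathbf{u},\mathbf{v},\mathbf{w}\}\cap\mathcal{M}_3$. The hyperbolic numbers are $\mathbb{D}=\{x+y\mathbf{j_1}:x,y\in\mathbb{R}\}\subset\mathbb{TC}$ (with $\mathbf{j_1}^2=1$), and the hyperbolic Mandelbrot set (Hyperbrot) is $\mathcal{H}=\{c\in\mathbb{D}:\{P_c^{(n)}(0)\}_{n\in\mathbb{N}}\text{ is bounded}\}$. For a set $S\subset\mathbb{TC}$ and $z\in\mathbb{TC}$, $S\pm z=\{s\pm z:s\in S\}$ and $-S=\{-s:s\in S\}$. *)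

theory Defs
  imports "HOL-Analysis.Analysis"
begin

text \<open>
  Adjoining a new commuting square root of \<open>-1\<close> to a commutative real algebra:
  \<open>Adj a b\<close> stands for \<open>a + b \<iota>\<close> with \<open>\<iota>\<^sup>2 = -1\<close>, regardless of whether \<open>'a\<close>
  already contains square roots of \<open>-1\<close>. The inner product is that of the direct sum.
  The resulting norm is not submultiplicative, so there is no instance of
  \<open>real_normed_algebra\<close>.
\<close>

datatype 'a adj = Adj (fst_part: 'a) (snd_part: 'a)

lemma adj_eq_iff: "x = y \<longleftrightarrow> fst_part x = fst_part y \<and> snd_part x = snd_part y"
  by (cases x; cases y) simp

instantiation adj :: (ab_group_add) ab_group_add
begin

definition "0 = Adj 0 0"
definition "x + y = Adj (fst_part x + fst_part y) (snd_part x + snd_part y)"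
definition "- x = Adj (- fst_part x) (- snd_part x)"
definition "x - y = Adj (fst_part x - fst_part y) (snd_part x - snd_part y)"

instance
  by standard (simp_all add: zero_adj_def plus_adj_def uminus_adj_def minus_adj_def adj_eq_iff)

end

instantiation adj :: (comm_ring_1) comm_ring_1
begin

definition "1 = Adj 1 0"
definition "x * y = Adj (fst_part x * fst_part y - snd_part x * snd_part y)
                        (fst_part x * snd_part y + snd_part x * fst_part y)"

instance
  by standard
    (simp_all add: zero_adj_def one_adj_def plus_adj_def times_adj_def adj_eq_iff algebra_simps)

end

instantiation adj :: (real_vector) real_vector
begin

definition "r *\<^sub>R x = Adj (r *\<^sub>R fst_part x) (r *\<^sub>R snd_part x)"

instance
  by standard (simp_all add: scaleR_adj_def plus_adj_def adj_eq_iff algebra_simps)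

end

instance adj :: ("{comm_ring_1, real_algebra_1}") real_algebra_1
  by standard (simp_all add: scaleR_adj_def times_adj_def adj_eq_iff algebra_simps)

instantiation adj :: (real_inner) real_inner
begin

definition "x \<bullet> y = fst_part x \<bullet> fst_part y + snd_part x \<bullet> snd_part y"
definition norm_adj :: "'a adj \<Rightarrow> real" where "norm_adj x = sqrt (x \<bullet> x)"
definition sgn_adj :: "'a adj \<Rightarrow> 'a adj" where "sgn_adj x = x /\<^sub>R norm x"
definition dist_adj :: "'a adj \<Rightarrow> 'a adj \<Rightarrow> real" where "dist_adj x y = norm (x - y)"
definition uniformity_adj :: "('a adj \<times> 'a adj) filter"
  where "uniformity_adj = (INF e\<in>{0 <..}. principal {(x, y). dist x y < e})"
definition open_adj :: "'a adj set \<Rightarrow> bool"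
  where "open_adj U \<longleftrightarrow> (\<forall>x\<in>U. eventually (\<lambda>(x', y). x' = x \<longrightarrow> y \<in> U) uniformity)"

instance
proof
  fix x y z :: "'a adj" and r :: real and U :: "'a adj set"
  show "dist x y = norm (x - y)"
    by (rule dist_adj_def)
  show "sgn x = x /\<^sub>R norm x"
    by (rule sgn_adj_def)
  show "(uniformity :: ('a adj \<times> 'a adj) filter) = (INF e\<in>{0 <..}. principal {(x, y). dist x y < e})"
    by (rule uniformity_adj_def)
  show "open U \<longleftrightarrow> (\<forall>x\<in>U. eventually (\<lambda>(x', y). x' = x \<longrightarrow> y \<in> U) uniformity)"
    by (rule open_adj_def)
  show "x \<bullet> y = y \<bullet> x"
    by (simp add: inner_adj_def inner_commute)
  show "(x + y) \<bullet> z = x \<bullet> z + y \<bullet> z"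
    by (simp add: inner_adj_def plus_adj_def inner_add_left)
  show "(r *\<^sub>R x) \<bullet> y = r * (x \<bullet> y)"
    by (simp add: inner_adj_def scaleR_adj_def distrib_left)
  show "0 \<le> x \<bullet> x"
    by (simp add: inner_adj_def)
  show "x \<bullet> x = 0 \<longleftrightarrow> x = 0"
    by (simp add: inner_adj_def zero_adj_def adj_eq_iff add_nonneg_eq_0_iff)
  show "norm x = sqrt (x \<bullet> x)"
    by (rule norm_adj_def)
qed

end


text \<open>Tricomplex numbers: \<open>\<complex>\<close> carries \<open>i1\<close>, and \<open>i2\<close>, then \<open>i3\<close>, are adjoined.\<close>

type_synonym bicomplex = "complex adj"
type_synonym tricomplex = "bicomplex adj"

definition i1 :: tricomplex where "i1 = Adj (Adj \<i> 0) 0"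
definition i2 :: tricomplex where "i2 = Adj (Adj 0 1) 0"
definition i3 :: tricomplex where "i3 = Adj 0 1"
definition j1 :: tricomplex where "j1 = i1 * i2"
definition j2 :: tricomplex where "j2 = i1 * i3"
definition j3 :: tricomplex where "j3 = i2 * i3"
definition i4 :: tricomplex where "i4 = i1 * i2 * i3"

lemmas units_def = i1_def i2_def i3_def j1_def j2_def j3_def i4_def

lemmas adj_ops_def = zero_adj_def one_adj_def plus_adj_def uminus_adj_def minus_adj_def
  times_adj_def scaleR_adj_def

lemma i_squared: "i1\<^sup>2 = -1" "i2\<^sup>2 = -1" "i3\<^sup>2 = -1"
  by (simp_all add: units_def adj_ops_def power2_eq_square)

lemma tricomplex_coords:
  "x *\<^sub>R 1 + a1 *\<^sub>R i1 + a2 *\<^sub>R i2 + b1 *\<^sub>R j1 + a3 *\<^sub>R i3 + b2 *\<^sub>R j2 + b3 *\<^sub>R j3 + a4 *\<^sub>R i4 =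
   Adj (Adj (Complex x a1) (Complex a2 b1)) (Adj (Complex a3 b2) (Complex b3 a4))"
  by (simp add: units_def adj_ops_def complex_eq_iff)

lemma tricomplex_basis:
  fixes z :: tricomplex
  shows "\<exists>!(x, a1, a2, b1, a3, b2, b3, a4).
    z = x *\<^sub>R 1 + a1 *\<^sub>R i1 + a2 *\<^sub>R i2 + b1 *\<^sub>R j1 + a3 *\<^sub>R i3 + b2 *\<^sub>R j2 + b3 *\<^sub>R j3 + a4 *\<^sub>R i4"
proof -
  obtain p q r s where z: "z = Adj (Adj p q) (Adj r s)"
    by (metis adj.exhaust)
  show ?thesis
    unfolding tricomplex_coords z
    by (rule ex1I[of _ "(Re p, Im p, Re q, Im q, Re r, Im r, Re s, Im s)"]) auto
qed

lemma norm_tricomplex: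
  "norm (x *\<^sub>R 1 + a1 *\<^sub>R i1 + a2 *\<^sub>R i2 + b1 *\<^sub>R j1 + a3 *\<^sub>R i3 + b2 *\<^sub>R j2 + b3 *\<^sub>R j3 + a4 *\<^sub>R i4) =
   sqrt (x\<^sup>2 + a1\<^sup>2 + a2\<^sup>2 + b1\<^sup>2 + a3\<^sup>2 + b2\<^sup>2 + b3\<^sup>2 + a4\<^sup>2)"
  unfolding tricomplex_coords
  by (simp add: norm_eq_sqrt_inner inner_adj_def inner_complex_def power2_eq_square add.assoc)


definition quad :: "tricomplex \<Rightarrow> tricomplex \<Rightarrow> tricomplex"
  where "quad c \<eta> = \<eta>\<^sup>2 + c"

definition bounded_orbit :: "tricomplex \<Rightarrow> bool"
  where "bounded_orbit c \<longleftrightarrow> bounded (range (\<lambda>n. (quad c ^^ n) 0))"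

definition mandelbrot3 :: "tricomplex set"
  where "mandelbrot3 = {c. bounded_orbit c}"

definition principal_slice :: "tricomplex \<Rightarrow> tricomplex \<Rightarrow> tricomplex \<Rightarrow> tricomplex set"
  where "principal_slice u v w = span {u, v, w} \<inter> mandelbrot3"

definition hyperbolic_numbers :: "tricomplex set"
  where "hyperbolic_numbers = {x *\<^sub>R 1 + y *\<^sub>R j1 | x y. True}"

definition hyperbrot :: "tricomplex set"
  where "hyperbrot = {c \<in> hyperbolic_numbers. bounded_orbit c}"

definition hyperbrot' :: "tricomplex set"
  where "hyperbrot' = {c7 *\<^sub>R j3 + c4 *\<^sub>R j1 | c4 c7. c7 *\<^sub>R 1 + c4 *\<^sub>R j1 \<in> hyperbrot}"

definition translate :: "tricomplex set \<Rightarrow> tricomplex \<Rightarrow> tricomplex set"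
  where "translate S z = (\<lambda>s. s + z) ` S"

text \<open>On sets, \<open>- S\<close> is the complement in HOL; this is the pointwise negation.\<close>

definition negate :: "tricomplex set \<Rightarrow> tricomplex set"
  where "negate S = uminus ` S"

end

theory Submission
  imports Defs
begin

text \<open>
  The products \<open>j1 * j2 = - j3\<close>, \<open>j1 * j3 = - j2\<close>, \<open>j2 * j3 = - j1\<close> and
  \<open>j1\<^sup>2 = j2\<^sup>2 = j3\<^sup>2 = 1\<close> make the span of \<open>1, j1, j2, j3\<close> a real algebra isomorphic to \<open>\<real>\<^sup>4\<close>
  with componentwise multiplication. The four coordinates are the algebra homomorphisms to \<open>\<real>\<close>;
  each sends \<open>(j1, j2, j3)\<close> to a triple of signs with product \<open>-1\<close>. Since the isomorphism commutes
  with squaring and respects boundedness, \<open>x + a j1 + b j2 + d j3\<close> lies in the tricomplex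
  Mandelbrot set iff its four images \<open>x + a + b - d\<close>, \<open>x + a - b + d\<close>, \<open>x - a + b + d\<close>,
  \<open>x - a - b - d\<close> have bounded real orbits (lemma \<open>bounded_orbit_iff\<close>).

  For \<open>d + a j1\<close> this leaves the two conditions on \<open>d + a\<close> and \<open>d - a\<close>, which therefore describe
  the membership of \<open>d j3 + a j1\<close> in \<open>\<H>'\<close>. Hence, at height \<open>b = y\<close>, the
  set \<open>\<H>' + y j1\<close> accounts for the two characters in which \<open>d\<close> occurs with sign \<open>+\<close> and \<open>a\<close>, \<open>y\<close> with
  opposite signs, and \<open>-\<H>' - y j1\<close> accounts for the other two: the intersection is exactly the slice.
  The range of \<open>y\<close> comes from \<open>c \<le> 1/4\<close> for every real \<open>c\<close> with bounded orbit
  (lemma \<open>bounded_real_orbit_le_quarter\<close>), because \<open>2 b\<close> and \<open>- 2 b\<close> are both sums of two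
  of the four images.
\<close>

definition bounded_real_orbit :: "real \<Rightarrow> bool"
  where "bounded_real_orbit c \<longleftrightarrow> bounded (range (\<lambda>n. ((\<lambda>t. t\<^sup>2 + c) ^^ n) 0))"

text \<open>
  The parabola \<open>t\<^sup>2 + c\<close> stays at least \<open>c - 1/4\<close> above the diagonal, so for \<open>c > 1/4\<close> every step
  of the orbit increases it by at least this fixed amount.
\<close>

lemma bounded_real_orbit_le_quarter:
  assumes "bounded_real_orbit c"
  shows "c \<le> 1/4"
proof (rule ccontr)
  assume "\<not> c \<le> 1/4"
  then have pos: "c - 1/4 > 0" by simp
  have lower: "real n * (c - 1/4) \<le> ((\<lambda>t. t\<^sup>2 + c) ^^ n) 0" for n
  proof (induction n)
    case (Suc n)
    let ?t = "((\<lambda>t. t\<^sup>2 + c) ^^ n) 0"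
    have "0 \<le> (?t - 1/2)\<^sup>2" by simp
    then have "?t + (c - 1/4) \<le> ?t\<^sup>2 + c"
      by (simp add: power2_eq_square algebra_simps)
    with Suc show ?case by (simp add: algebra_simps add_divide_distrib)
  qed simp
  obtain B where B: "\<bar>((\<lambda>t. t\<^sup>2 + c) ^^ n) 0\<bar> \<le> B" for n
    using assms by (auto simp: bounded_real_orbit_def bounded_iff)
  obtain n where "B < real n * (c - 1/4)"
    using ex_less_of_nat_mult[OF pos] by blast
  with lower[of n] B[of n] show False by linarith
qed


text \<open>
  The inverse of the isomorphism onto \<open>\<real>\<^sup>4\<close>: the element whose images under the homomorphisms
  \<open>(j1, j2, j3) \<mapsto> (1, 1, -1), (1, -1, 1), (-1, 1, 1), (-1, -1, -1)\<close> are \<open>p, q, r, s\<close>.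
\<close>

definition of_characters :: "real \<Rightarrow> real \<Rightarrow> real \<Rightarrow> real \<Rightarrow> tricomplex"
  where "of_characters p q r s =
    ((p + q + r + s) / 4) *\<^sub>R 1 + ((p + q - r - s) / 4) *\<^sub>R j1 +
    ((p - q + r - s) / 4) *\<^sub>R j2 + ((- p + q + r - s) / 4) *\<^sub>R j3"

lemma of_characters_coords:
  "of_characters p q r s =
   Adj (Adj (Complex ((p + q + r + s) / 4) 0) (Complex 0 ((p + q - r - s) / 4)))
       (Adj (Complex 0 ((p - q + r - s) / 4)) (Complex ((- p + q + r - s) / 4) 0))"
  by (simp add: of_characters_def units_def adj_ops_def complex_eq_iff)

lemma of_characters_eq:
  "x *\<^sub>R 1 + a *\<^sub>R j1 + b *\<^sub>R j2 + d *\<^sub>R j3 =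
   of_characters (x + a + b - d) (x + a - b + d) (x - a + b + d) (x - a - b - d)"
  by (simp add: of_characters_def)

lemma quad_of_characters:
  "quad (of_characters p q r s) (of_characters p' q' r' s') =
   of_characters (p'\<^sup>2 + p) (q'\<^sup>2 + q) (r'\<^sup>2 + r) (s'\<^sup>2 + s)"
  by (simp add: quad_def of_characters_coords adj_ops_def complex_eq_iff power2_eq_square field_simps)

lemma orbit_of_characters:
  "(quad (of_characters p q r s) ^^ n) 0 =
   of_characters (((\<lambda>t. t\<^sup>2 + p) ^^ n) 0) (((\<lambda>t. t\<^sup>2 + q) ^^ n) 0)
                 (((\<lambda>t. t\<^sup>2 + r) ^^ n) 0) (((\<lambda>t. t\<^sup>2 + s) ^^ n) 0)"
proof (induction n)
  case 0
  show ?case by (simp add: of_characters_def)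
qed (simp add: quad_of_characters)

text \<open>The four primitive idempotents are orthogonal and have norm \<open>1/2\<close>.\<close>

lemma norm_of_characters:
  "norm (of_characters p q r s) = sqrt (p\<^sup>2 + q\<^sup>2 + r\<^sup>2 + s\<^sup>2) / 2"
proof -
  have "of_characters p q r s \<bullet> of_characters p q r s = (p\<^sup>2 + q\<^sup>2 + r\<^sup>2 + s\<^sup>2) / 2\<^sup>2"
    by (simp add: of_characters_coords inner_adj_def inner_complex_def power2_eq_square field_simps)
  then show ?thesis
    unfolding norm_eq_sqrt_inner by (simp only: real_sqrt_divide real_sqrt_abs abs_numeral)
qed

lemma bounded_of_characters_iff:
  "bounded (range (\<lambda>n. of_characters (f n) (g n) (h n) (k n))) \<longleftrightarrow>
   bounded (range f) \<and> bounded (range g) \<and> bounded (range h) \<and> bounded (range k)"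
  (is "bounded (range ?F) \<longleftrightarrow> _")
proof
  assume "bounded (range ?F)"
  then obtain B where B: "norm (?F n) \<le> B" for n
    by (auto simp: bounded_iff)
  have "\<bar>f n\<bar> \<le> 2 * B \<and> \<bar>g n\<bar> \<le> 2 * B \<and> \<bar>h n\<bar> \<le> 2 * B \<and> \<bar>k n\<bar> \<le> 2 * B" for n
  proof -
    have "sqrt ((f n)\<^sup>2 + (g n)\<^sup>2 + (h n)\<^sup>2 + (k n)\<^sup>2) \<le> 2 * B"
      using B[of n] by (simp add: norm_of_characters)
    moreover have "\<bar>u\<bar> \<le> sqrt ((f n)\<^sup>2 + (g n)\<^sup>2 + (h n)\<^sup>2 + (k n)\<^sup>2)"
      if "u \<in> {f n, g n, h n, k n}" for u
      using that by (intro real_le_rsqrt) auto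
    ultimately show ?thesis by force
  qed
  then show "bounded (range f) \<and> bounded (range g) \<and> bounded (range h) \<and> bounded (range k)"
    by (auto simp: bounded_iff)
next
  assume "bounded (range f) \<and> bounded (range g) \<and> bounded (range h) \<and> bounded (range k)"
  then obtain A B C D where
    "\<And>n. \<bar>f n\<bar> \<le> A" "\<And>n. \<bar>g n\<bar> \<le> B" "\<And>n. \<bar>h n\<bar> \<le> C" "\<And>n. \<bar>k n\<bar> \<le> D"
    by (auto simp: bounded_iff)
  then have "(f n)\<^sup>2 + (g n)\<^sup>2 + (h n)\<^sup>2 + (k n)\<^sup>2 \<le> A\<^sup>2 + B\<^sup>2 + C\<^sup>2 + D\<^sup>2" for n
    by (intro add_mono) (metis abs_ge_zero power2_abs power_mono)+
  then show "bounded (range ?F)"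
    by (auto simp: bounded_iff norm_of_characters
        intro!: exI[of _ "sqrt (A\<^sup>2 + B\<^sup>2 + C\<^sup>2 + D\<^sup>2) / 2"])
qed

lemma bounded_orbit_iff:
  "bounded_orbit (x *\<^sub>R 1 + a *\<^sub>R j1 + b *\<^sub>R j2 + d *\<^sub>R j3) \<longleftrightarrow>
   bounded_real_orbit (x + a + b - d) \<and> bounded_real_orbit (x + a - b + d) \<and>
   bounded_real_orbit (x - a + b + d) \<and> bounded_real_orbit (x - a - b - d)"
  by (simp add: of_characters_eq bounded_orbit_def orbit_of_characters bounded_of_characters_iff
      bounded_real_orbit_def)


lemma j1_j3_independent:
  "d *\<^sub>R j3 + a *\<^sub>R j1 = d' *\<^sub>R j3 + a' *\<^sub>R j1 \<longleftrightarrow> d = d' \<and> a = a'"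
  by (auto simp: units_def adj_ops_def complex_eq_iff)

text \<open>On \<open>x + y j1\<close> the four characters coincide in pairs.\<close>

lemma mem_hyperbrot_iff:
  "x *\<^sub>R 1 + y *\<^sub>R j1 \<in> hyperbrot \<longleftrightarrow> bounded_real_orbit (x + y) \<and> bounded_real_orbit (x - y)"
  using bounded_orbit_iff[of x y 0 0]
  by (auto simp: hyperbrot_def hyperbolic_numbers_def)

lemma mem_hyperbrot'_iff:
  "d *\<^sub>R j3 + a *\<^sub>R j1 \<in> hyperbrot' \<longleftrightarrow> bounded_real_orbit (d + a) \<and> bounded_real_orbit (d - a)"
  by (auto simp: hyperbrot'_def j1_j3_independent mem_hyperbrot_iff)

lemma mem_translate_iff: "w \<in> translate S z \<longleftrightarrow> w - z \<in> S"
  by (force simp: translate_def)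

lemma mem_negate_iff: "w \<in> negate S \<longleftrightarrow> - w \<in> S"
  by (force simp: negate_def)

lemma mem_slice_iff:
  "z \<in> principal_slice j1 j2 j3 \<longleftrightarrow>
   (\<exists>a b d. z = a *\<^sub>R j1 + b *\<^sub>R j2 + d *\<^sub>R j3 \<and>
     bounded_real_orbit (a + b - d) \<and> bounded_real_orbit (a - b + d) \<and>
     bounded_real_orbit (- a + b + d) \<and> bounded_real_orbit (- a - b - d))"
proof -
  have "z \<in> span {j1, j2, j3} \<longleftrightarrow> (\<exists>a b d. z = a *\<^sub>R j1 + b *\<^sub>R j2 + d *\<^sub>R j3)"
    by (simp add: span_breakdown_eq algebra_simps)
  moreover have "a *\<^sub>R j1 + b *\<^sub>R j2 + d *\<^sub>R j3 \<in> mandelbrot3 \<longleftrightarrow>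
      bounded_real_orbit (a + b - d) \<and> bounded_real_orbit (a - b + d) \<and>
      bounded_real_orbit (- a + b + d) \<and> bounded_real_orbit (- a - b - d)" for a b d
    using bounded_orbit_iff[of 0 a b d] by (simp add: mandelbrot3_def)
  ultimately show ?thesis
    unfolding principal_slice_def Int_iff by blast
qed

theorem proposition6:
  shows "principal_slice j1 j2 j3 =
    (\<Union>y\<in>{-1/4..1/4::real}.
       translate (translate hyperbrot' (y *\<^sub>R j1) \<inter> translate (negate hyperbrot') (- (y *\<^sub>R j1)))
                 (y *\<^sub>R j2))"
proof (intro set_eqI iffI)
  fix z
  assume "z \<in> principal_slice j1 j2 j3"
  then obtain a b d where z: "z = a *\<^sub>R j1 + b *\<^sub>R j2 + d *\<^sub>R j3"
    and bnd: "bounded_real_orbit (a + b - d)" "bounded_real_orbit (a - b + d)"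
      "bounded_real_orbit (- a + b + d)" "bounded_real_orbit (- a - b - d)"
    by (auto simp: mem_slice_iff)
  \<comment> \<open>The first and third images add up to \<open>2 * b\<close>, the second and fourth to \<open>- 2 * b\<close>.\<close>
  have b: "b \<in> {-1/4..1/4}"
    using bnd[THEN bounded_real_orbit_le_quarter] by simp
  have "z - b *\<^sub>R j2 - b *\<^sub>R j1 = d *\<^sub>R j3 + (a - b) *\<^sub>R j1"
    "- (z - b *\<^sub>R j2 - - (b *\<^sub>R j1)) = (- d) *\<^sub>R j3 + (- a - b) *\<^sub>R j1"
    by (simp_all add: z algebra_simps)
  then have "z - b *\<^sub>R j2 - b *\<^sub>R j1 \<in> hyperbrot'" "- (z - b *\<^sub>R j2 - - (b *\<^sub>R j1)) \<in> hyperbrot'"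
    using bnd by (simp_all only: mem_hyperbrot'_iff) (simp_all add: algebra_simps)
  with b show "z \<in> (\<Union>y\<in>{-1/4..1/4::real}.
       translate (translate hyperbrot' (y *\<^sub>R j1) \<inter> translate (negate hyperbrot') (- (y *\<^sub>R j1)))
                 (y *\<^sub>R j2))"
    unfolding UN_iff mem_translate_iff Int_iff mem_negate_iff by blast
next
  fix z
  assume "z \<in> (\<Union>y\<in>{-1/4..1/4::real}.
       translate (translate hyperbrot' (y *\<^sub>R j1) \<inter> translate (negate hyperbrot') (- (y *\<^sub>R j1)))
                 (y *\<^sub>R j2))"
  then obtain y where upper: "z - y *\<^sub>R j2 - y *\<^sub>R j1 \<in> hyperbrot'"
    and lower: "- (z - y *\<^sub>R j2 - - (y *\<^sub>R j1)) \<in> hyperbrot'"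
    unfolding UN_iff mem_translate_iff Int_iff mem_negate_iff by blast
  from upper obtain a d where ad: "z - y *\<^sub>R j2 - y *\<^sub>R j1 = d *\<^sub>R j3 + a *\<^sub>R j1"
    by (auto simp: hyperbrot'_def)
  then have z: "z = (a + y) *\<^sub>R j1 + y *\<^sub>R j2 + d *\<^sub>R j3"
    by (simp add: algebra_simps)
  have "- (z - y *\<^sub>R j2 - - (y *\<^sub>R j1)) = (- d) *\<^sub>R j3 + (- a - 2 * y) *\<^sub>R j1"
    by (simp add: z algebra_simps flip: scaleR_2)
  with lower have "bounded_real_orbit (- d + (- a - 2 * y))" "bounded_real_orbit (- d - (- a - 2 * y))"
    by (simp_all only: mem_hyperbrot'_iff)
  moreover from upper ad have "bounded_real_orbit (d + a)" "bounded_real_orbit (d - a)"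
    by (simp_all only: mem_hyperbrot'_iff)
  ultimately show "z \<in> principal_slice j1 j2 j3"
    unfolding mem_slice_iff
    by (intro exI[of _ "a + y"] exI[of _ y] exI[of _ d]) (simp add: z algebra_simps)
qed

end
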